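(* Let $v_F,\hbar,m,\theta>0$, $a<b$ and $V_0\neq0$ be real constants, and let $V(r)=V_0$ for $a<r<b$ and $V(r)=0$ otherwise. Let $M=(n_s,J_s)_{s=0,1,2,3}$ be a piecewise-constant 8-tuple with $n_0>0$. Then $M$ is a solution, in the sense of distributions on $\mathbb{R}^2$, of the system (QFDE) with this potential $V$ (see context) if and only if there exist constants $\beta_0,\beta_1\in\mathbb{R}$ such that $$\left\{\begin{aligned}&n_2=n_3=J_2=J_3=0,\\&v_FJ_0(r)+n_1V(r)=\beta_0,\\&v_FJ_1(r)+n_0V(r)=\beta_1,\end{aligned}\right.$$ for all $r\in\mathbb{R}\setminus\{a,b\}$.
   Context: The system (QFDE) for real-valued $(n_s,J_s)_{s=0,1,2,3}$ depending on $(r,t)\in\mathbb{R}^2$ is $$\partial_t n_0+v_F\partial_r n_1=0,\qquad \partial_t n_1+v_F\partial_r n_0=0,$$ $$\partial_t n_2+\frac{2v_F}{\hbar}J_3=0,\qquad \partial_t n_3-\frac{2v_F}{\hbar}J_2=0,$$ $$\partial_t J_0+v_F\partial_r J_1+n_0\frac{dV}{dr}=0,\qquad \partial_t J_1+v_F\partial_r J_0+n_1\frac{dV}{dr}=0,$$ $$\partial_t J_2+\frac{2v_F}{\hbar}\Big[\Big(m\theta-\frac{J_0^2}{n_0^2}\Big)n_3+\frac{2}{n_0}J_0J_3\Big]+n_2\frac{dV}{dr}=0,$$ $$\partial_t J_3-\frac{2v_F}{\hbar}\Big[\Big(m\theta-\frac{J_0^2}{n_0^2}\Big)n_2+\frac{2}{n_0}J_0J_2\Big]+n_3\frac{dV}{dr}=0.$$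 All derivatives are distributional derivatives on $\mathbb{R}^2$, and $\frac{dV}{dr}=V_0(\delta(r-a)-\delta(r-b))$, so that for continuous $n_s$ the term $n_s\frac{dV}{dr}$ is the distribution $\varphi\mapsto V_0\int_{\mathbb{R}}\big(n_s(a,t)\varphi(a,t)-n_s(b,t)\varphi(b,t)\big)\,dt$. Let $\Omega_1=\{(r,t)\in\mathbb{R}^2:r<a\}$, $\Omega_2=\{(r,t)\in\mathbb{R}^2:a<r<b\}$, $\Omega_3=\{(r,t)\in\mathbb{R}^2:r>b\}$. An 8-tuple $(n_s,J_s)_{s=0,1,2,3}$ of real-valued functions on $\mathbb{R}^2$ is piecewise-constant if, for $s=0,1,2,3$, $n_s$ is constant on $\mathbb{R}^2$ and $J_s$ is constant on each of $\Omega_1,\Omega_2,\Omega_3$ (so that, off the lines $r=a$ and $r=b$, $J_s$ depends only on $r$ and is written $J_s(r)$). *)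

theory Defs
  imports "HOL-Analysis.Analysis"
begin

text \<open>Points of the plane are pairs \<open>(r, t)\<close>.\<close>

definition partial_r :: "(real \<times> real \<Rightarrow> real) \<Rightarrow> real \<times> real \<Rightarrow> real" where
  "partial_r f p = deriv (\<lambda>x. f (x, snd p)) (fst p)"

definition partial_t :: "(real \<times> real \<Rightarrow> real) \<Rightarrow> real \<times> real \<Rightarrow> real" where
  "partial_t f p = deriv (\<lambda>y. f (fst p, y)) (snd p)"

text \<open>\<open>C_k k f\<close>: all iterated partial derivatives of order at most \<open>k\<close> exist and are continuous.\<close>

fun C_k :: "nat \<Rightarrow> (real \<times> real \<Rightarrow> real) \<Rightarrow> bool" where
  "C_k 0 f \<longleftrightarrow> continuous_on UNIV f"
| "C_k (Suc k) f \<longleftrightarrow>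
     continuous_on UNIV f \<and>
     (\<forall>r t. (\<lambda>x. f (x, t)) field_differentiable (at r) \<and>
            (\<lambda>y. f (r, y)) field_differentiable (at t)) \<and>
     C_k k (partial_r f) \<and> C_k k (partial_t f)"

definition test_function :: "(real \<times> real \<Rightarrow> real) \<Rightarrow> bool" where
  "test_function \<phi> \<longleftrightarrow> (\<forall>k. C_k k \<phi>) \<and> compact (closure {p. \<phi> p \<noteq> 0})"

text \<open>Distributions are represented by their action on test functions; equations between
  them are required only at arguments satisfying \<open>test_function\<close>.\<close>

type_synonym distr = "(real \<times> real \<Rightarrow> real) \<Rightarrow> real"

definition locally_integrable :: "(real \<times> real \<Rightarrow> real) \<Rightarrow> bool" where
  "locally_integrable f \<longleftrightarrow> (\<forall>K. compact K \<longrightarrow> f absolutely_integrable_on K)"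

definition regular_distr :: "(real \<times> real \<Rightarrow> real) \<Rightarrow> distr" where
  "regular_distr f \<phi> = (LINT p|lebesgue. f p * \<phi> p)"

definition distr_dr :: "distr \<Rightarrow> distr" where
  "distr_dr T \<phi> = - T (partial_r \<phi>)"

definition distr_dt :: "distr \<Rightarrow> distr" where
  "distr_dt T \<phi> = - T (partial_t \<phi>)"

definition potential :: "real \<Rightarrow> real \<Rightarrow> real \<Rightarrow> real \<Rightarrow> real" where
  "potential a b V0 r = (if a < r \<and> r < b then V0 else 0)"

text \<open>The product of a continuous function \<open>n\<close> with the derivative
  \<open>V0 (\<delta>(r - a) - \<delta>(r - b))\<close> of \<open>potential a b V0\<close>.\<close>

definition mult_dV :: "real \<Rightarrow> real \<Rightarrow> real \<Rightarrow> (real \<times> real \<Rightarrow> real) \<Rightarrow> distr" where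
  "mult_dV a b V0 n \<phi> =
     V0 * (LINT t|lebesgue. n (a, t) * \<phi> (a, t) - n (b, t) * \<phi> (b, t))"

text \<open>The bracket in the equations for \<open>J\<^sub>2\<close> (with \<open>s = 3\<close>) and \<open>J\<^sub>3\<close> (with \<open>s = 2\<close>).\<close>

definition QFDE_bracket ::
  "real \<Rightarrow> real \<Rightarrow> (nat \<Rightarrow> real \<times> real \<Rightarrow> real) \<Rightarrow> (nat \<Rightarrow> real \<times> real \<Rightarrow> real) \<Rightarrow>
   nat \<Rightarrow> real \<times> real \<Rightarrow> real" where
  "QFDE_bracket m \<theta> n J s p =
     (m * \<theta> - (J 0 p)\<^sup>2 / (n 0 p)\<^sup>2) * n s p + 2 / n 0 p * J 0 p * J s p"

text \<open>An 8-tuple is given by \<open>n s\<close> and \<open>J s\<close> for \<open>s < 4\<close>; other indices are irrelevant.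
  The conditions preceding the equations say that every term of the system is a well-defined
  distribution; in particular the Bochner integrals in \<open>regular_distr\<close> and \<open>mult_dV\<close> then
  converge for every test function.\<close>

definition QFDE_solution ::
  "real \<Rightarrow> real \<Rightarrow> real \<Rightarrow> real \<Rightarrow> real \<Rightarrow> real \<Rightarrow> real \<Rightarrow>
   (nat \<Rightarrow> real \<times> real \<Rightarrow> real) \<Rightarrow> (nat \<Rightarrow> real \<times> real \<Rightarrow> real) \<Rightarrow> bool" where
  "QFDE_solution vF hbar m \<theta> a b V0 n J \<longleftrightarrow>
     (\<forall>s<4. continuous_on UNIV (n s) \<and> locally_integrable (J s)) \<and>
     (\<forall>p. n 0 p \<noteq> 0) \<and>
     (\<forall>s\<in>{2, 3}. locally_integrable (QFDE_bracket m \<theta> n J s)) \<and>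
     (\<forall>\<phi>. test_function \<phi> \<longrightarrow>
        distr_dt (regular_distr (n 0)) \<phi> + vF * distr_dr (regular_distr (n 1)) \<phi> = 0 \<and>
        distr_dt (regular_distr (n 1)) \<phi> + vF * distr_dr (regular_distr (n 0)) \<phi> = 0 \<and>
        distr_dt (regular_distr (n 2)) \<phi> + 2 * vF / hbar * regular_distr (J 3) \<phi> = 0 \<and>
        distr_dt (regular_distr (n 3)) \<phi> - 2 * vF / hbar * regular_distr (J 2) \<phi> = 0 \<and>
        distr_dt (regular_distr (J 0)) \<phi> + vF * distr_dr (regular_distr (J 1)) \<phi>
          + mult_dV a b V0 (n 0) \<phi> = 0 \<and>
        distr_dt (regular_distr (J 1)) \<phi> + vF * distr_dr (regular_distr (J 0)) \<phi>
          + mult_dV a b V0 (n 1) \<phi> = 0 \<and>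
        distr_dt (regular_distr (J 2)) \<phi>
          + 2 * vF / hbar * regular_distr (QFDE_bracket m \<theta> n J 3) \<phi>
          + mult_dV a b V0 (n 2) \<phi> = 0 \<and>
        distr_dt (regular_distr (J 3)) \<phi>
          - 2 * vF / hbar * regular_distr (QFDE_bracket m \<theta> n J 2) \<phi>
          + mult_dV a b V0 (n 3) \<phi> = 0)"

text \<open>No condition is imposed on the values of \<open>J s\<close> on the lines \<open>r = a\<close> and \<open>r = b\<close>.\<close>

definition piecewise_constant ::
  "real \<Rightarrow> real \<Rightarrow> (nat \<Rightarrow> real \<times> real \<Rightarrow> real) \<Rightarrow> (nat \<Rightarrow> real \<times> real \<Rightarrow> real) \<Rightarrow> bool" where
  "piecewise_constant a b n J \<longleftrightarrow>
     (\<forall>s<4. n s constant_on UNIV \<and>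
            J s constant_on {(r, t). r < a} \<and>
            J s constant_on {(r, t). a < r \<and> r < b} \<and>
            J s constant_on {(r, t). b < r})"

end

theory Submission
  imports Defs
begin

text \<open>Away from the lines \<open>r = a\<close> and \<open>r = b\<close> every term of the system is constant on each region, so
  by Fubini and the fundamental theorem of calculus time derivatives vanish and \<open>\<partial>\<^sub>r J\<^sub>s\<close> is the jump of
  \<open>J\<^sub>s\<close> times a delta on each line. Each equation thus has the form \<open>f + p \<delta>(r - a) + q \<delta>(r - b) = 0\<close>
  with \<open>f\<close> piecewise constant. Testing with bumps supported inside one region gives \<open>f = 0\<close>, and
  then bumps around a single line give \<open>p = q = 0\<close>. For \<open>s = 2, 3\<close> this gives \<open>V\<^sub>0 n\<^sub>s = 0\<close>; for
  \<open>s = 0, 1\<close> it says that the jumps of \<open>v\<^sub>F J\<^sub>s\<close> cancel those of \<open>n\<^sub>1\<^sub>-\<^sub>s V\<close>.\<close>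

subsection \<open>Smooth bump functions\<close>

text \<open>For \<open>p = 1\<close> this is the classical smooth, non-analytic function exp(-1/x),
  extended by zero. The polynomial in 1/x makes the family closed under differentiation.\<close>

definition flat :: "real poly \<Rightarrow> real \<Rightarrow> real" where
  "flat p x = (if x > 0 then poly p (1 / x) * exp (- (1 / x)) else 0)"

text \<open>Substituting y = 1/x turns this into the decay of y^i / exp y at infinity, applied to
  each monomial of \<open>p\<close>.\<close>

lemma flat_tendsto_0: "((\<lambda>x. poly p (1 / x) * exp (- (1 / x))) \<longlongrightarrow> 0) (at_right (0::real))"
proof -
  have "((\<lambda>y. \<Sum>i\<le>degree p. coeff p i * (y ^ i / exp y)) \<longlongrightarrow> (\<Sum>i\<le>degree p. coeff p i * 0)) (at_top :: real filter)"
    by (intro tendsto_intros tendsto_power_div_exp_0)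
  moreover have "poly p y * exp (- y) = (\<Sum>i\<le>degree p. coeff p i * (y ^ i / exp y))" for y
    by (simp add: poly_altdef exp_minus sum_distrib_right divide_simps)
  ultimately have "((\<lambda>y. poly p y * exp (- y)) \<longlongrightarrow> 0) (at_top :: real filter)"
    by simp
  from filterlim_compose[OF this filterlim_inverse_at_top_right]
  show ?thesis by (simp add: inverse_eq_divide)
qed

text \<open>For x > 0 the chain rule through y = 1/x gives y^2 (p(y) - p'(y)) exp(-y), and
  \<open>[:0, 0, 1:]\<close> is the polynomial y^2. Only x = 0 needs a limit.\<close>

lemma flat_DERIV: "(flat p has_real_derivative flat ([:0, 0, 1:] * (p - pderiv p)) x) (at x)"
proof (cases x "0 :: real" rule: linorder_cases)
  case less
  have "((\<lambda>_. 0) has_real_derivative 0) (at x)" by simp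
  then have "(flat p has_real_derivative 0) (at x)"
    by (rule has_field_derivative_transform_within_open[where S = "{..<0}"])
      (use less in \<open>auto simp: flat_def\<close>)
  then show ?thesis using less by (simp add: flat_def)
next
  case equal
  have "((\<lambda>h. flat p h / h) \<longlongrightarrow> 0) (at_left 0)"
    by (rule Lim_transform_eventually[OF tendsto_const])
      (auto simp: flat_def eventually_at_left_field intro!: exI[of _ "-1"])
  \<comment> \<open>For h > 0, division by \<open>h\<close> multiplies \<open>p\<close> by its
    variable, so the quotient is again of the form that tends to 0.\<close>
  moreover have "((\<lambda>h. flat p h / h) \<longlongrightarrow> 0) (at_right 0)"
    by (rule Lim_transform_eventually[OF flat_tendsto_0[of "[:0, 1:] * p"]])
      (auto simp: flat_def eventually_at_right_field intro!: exI[of _ 1])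
  ultimately have "((\<lambda>h. flat p h / h) \<longlongrightarrow> 0) (at 0)"
    by (simp add: filterlim_split_at)
  then show ?thesis using equal by (simp add: DERIV_def flat_def)
next
  case greater
  have "((\<lambda>x. poly p (1 / x) * exp (- (1 / x))) has_real_derivative
      flat ([:0, 0, 1:] * (p - pderiv p)) x) (at x)"
    using greater
    by (auto intro!: derivative_eq_intros poly_DERIV[THEN DERIV_chain2]
      simp: flat_def power2_eq_square field_simps)
  then show ?thesis
    by (rule has_field_derivative_transform_within_open[where S = "{0<..}"])
      (use greater in \<open>auto simp: flat_def\<close>)
qed

text \<open>The derivative is an existential witness rather than \<open>deriv\<close>, so closure
  proofs can supply an explicit formula and recurse on it.\<close>

fun C_k_real :: "nat \<Rightarrow> (real \<Rightarrow> real) \<Rightarrow> bool" where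
  "C_k_real 0 f \<longleftrightarrow> continuous_on UNIV f"
| "C_k_real (Suc k) f \<longleftrightarrow> (\<exists>f'. (\<forall>x. (f has_real_derivative f' x) (at x)) \<and> C_k_real k f')"

lemma C_k_real_continuous: "C_k_real k f \<Longrightarrow> continuous_on UNIV f"
  by (cases k) (auto intro: DERIV_continuous_on DERIV_subset)

lemma C_k_real_Suc_D: "C_k_real (Suc k) f \<Longrightarrow> C_k_real k f"
proof (induction k arbitrary: f)
  case 0
  then show ?case using C_k_real_continuous[OF 0] by simp
next
  case (Suc k)
  then show ?case by (metis C_k_real.simps(2))
qed

lemma C_k_real_add: "C_k_real k f \<Longrightarrow> C_k_real k g \<Longrightarrow> C_k_real k (\<lambda>x. f x + g x)"
proof (induction k arbitrary: f g)
  case 0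
  then show ?case by (auto intro: continuous_intros)
next
  case (Suc k)
  then obtain f' g' where
    "\<forall>x. (f has_real_derivative f' x) (at x)" "C_k_real k f'"
    "\<forall>x. (g has_real_derivative g' x) (at x)" "C_k_real k g'"
    by auto
  with Suc.IH show ?case
    by (auto intro!: exI[of _ "\<lambda>x. f' x + g' x"] derivative_intros)
qed

lemma C_k_real_mult: "C_k_real k f \<Longrightarrow> C_k_real k g \<Longrightarrow> C_k_real k (\<lambda>x. f x * g x)"
proof (induction k arbitrary: f g)
  case 0
  then show ?case by (auto intro: continuous_intros)
next
  case (Suc k)
  then obtain f' g' where
    d: "\<forall>x. (f has_real_derivative f' x) (at x)" "C_k_real k f'"
    "\<forall>x. (g has_real_derivative g' x) (at x)" "C_k_real k g'"
    by auto
  \<comment> \<open>The product rule keeps undifferentiated factors, so \<open>f\<close> and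
    \<open>g\<close> themselves are lowered to order \<open>k\<close> before the induction
    hypothesis applies.\<close>
  have "C_k_real k (\<lambda>x. f' x * g x + g' x * f x)"
    using Suc.prems[THEN C_k_real_Suc_D] by (intro C_k_real_add Suc.IH d)
  moreover have "((\<lambda>x. f x * g x) has_real_derivative f' x * g x + g' x * f x) (at x)" for x
    using d by (auto intro: DERIV_mult)
  ultimately show ?case
    by (auto intro!: exI[of _ "\<lambda>x. f' x * g x + g' x * f x"])
qed

text \<open>Each differentiation replaces \<open>p\<close> and multiplies the scalar by
  \<open>c\<close>; hence \<open>s\<close> and \<open>p\<close> vary in the induction while
  \<open>c\<close> and \<open>d\<close> stay fixed.\<close>

lemma C_k_real_affine_flat: "C_k_real k (\<lambda>x. s * flat p (c * x + d))"
proof (induction k arbitrary: s p)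
  case 0
  have "continuous_on UNIV (flat p)"
    by (rule DERIV_continuous_on[OF DERIV_subset[OF flat_DERIV]]) auto
  then show ?case
    by (auto intro!: continuous_intros elim!: continuous_on_compose2)
next
  case (Suc k)
  have "((\<lambda>x. s * flat p (c * x + d)) has_real_derivative
      (s * c) * flat ([:0, 0, 1:] * (p - pderiv p)) (c * x + d)) (at x)" for x
    by (auto intro!: derivative_eq_intros flat_DERIV[THEN DERIV_chain2])
  then show ?case
    using Suc by (auto intro!: exI[of _ "\<lambda>x. (s * c) * flat ([:0, 0, 1:] * (p - pderiv p)) (c * x + d)"]
      simp del: mult_pCons_left)
qed

text \<open>Here \<open>1\<close> is the constant polynomial: each factor is exp(-1/y) for y > 0 and
  switches off smoothly at one end point.\<close>

definition bump :: "real \<Rightarrow> real \<Rightarrow> real \<Rightarrow> real" where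
  "bump l u x = flat 1 (x - l) * flat 1 (u - x)"

lemma C_k_real_bump: "C_k_real k (bump l u)"
  using C_k_real_mult[OF C_k_real_affine_flat[of k 1 1 1 "- l"] C_k_real_affine_flat[of k 1 1 "- 1" u]]
  by (simp add: bump_def[abs_def])

lemma bump_nonneg: "bump l u x \<ge> 0"
  by (simp add: bump_def flat_def)

lemma bump_pos_iff: "bump l u x > 0 \<longleftrightarrow> l < x \<and> x < u"
  by (simp add: bump_def flat_def)

lemma bump_nonzero_iff: "bump l u x \<noteq> 0 \<longleftrightarrow> l < x \<and> x < u"
  by (simp add: bump_def flat_def)

text \<open>A partial derivative of g(r) h(t) differentiates one factor only, so the product form
  survives the induction.\<close>

lemma C_k_tensor:
  "C_k_real k g \<Longrightarrow> C_k_real k h \<Longrightarrow> C_k k (\<lambda>p. g (fst p) * h (snd p))"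
proof (induction k arbitrary: g h)
  case 0
  then show ?case
    by (auto intro!: continuous_intros elim!: continuous_on_compose2)
next
  case (Suc k)
  then obtain g' h' where
    d: "\<And>x. (g has_real_derivative g' x) (at x)" "C_k_real k g'"
    "\<And>x. (h has_real_derivative h' x) (at x)" "C_k_real k h'"
    by auto
  have dr: "((\<lambda>x. g x * h t) has_real_derivative g' r * h t) (at r)"
    and dt: "((\<lambda>y. g r * h y) has_real_derivative g r * h' t) (at t)" for r t
    using d(1)[of r] d(3)[of t] by (auto intro!: derivative_eq_intros)
  have "partial_r (\<lambda>p. g (fst p) * h (snd p)) = (\<lambda>p. g' (fst p) * h (snd p))"
    using dr by (auto simp: fun_eq_iff partial_r_def intro!: DERIV_imp_deriv)
  moreover have "partial_t (\<lambda>p. g (fst p) * h (snd p)) = (\<lambda>p. g (fst p) * h' (snd p))"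
    using dt by (auto simp: fun_eq_iff partial_t_def intro!: DERIV_imp_deriv)
  moreover have "continuous_on UNIV g" "continuous_on UNIV h"
    using Suc.prems C_k_real_continuous by blast+
  then have "continuous_on UNIV (\<lambda>p. g (fst p) * h (snd p))"
    by (auto intro!: continuous_intros elim!: continuous_on_compose2)
  moreover have "C_k k (\<lambda>p. g' (fst p) * h (snd p))" "C_k k (\<lambda>p. g (fst p) * h' (snd p))"
    using Suc d C_k_real_Suc_D by blast+
  ultimately show ?case
    using dr dt by (auto simp: field_differentiable_def) blast
qed

lemma test_function_bump: "test_function (\<lambda>p. bump l u (fst p) * bump l' u' (snd p))"
proof -
  have "{p. bump l u (fst p) * bump l' u' (snd p) \<noteq> 0} \<subseteq> cbox (l, l') (u, u')"
    by (auto simp: cbox_Pair_eq bump_nonzero_iff)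
  then have "bounded {p. bump l u (fst p) * bump l' u' (snd p) \<noteq> 0}"
    using bounded_cbox bounded_subset by blast
  then show ?thesis
    by (simp add: test_function_def C_k_tensor C_k_real_bump)
qed

subsection \<open>Derivatives of piecewise constant functions\<close>

text \<open>One-dimensional version of the fact that the derivative of a Heaviside step at
  \<open>c\<close> is the delta at \<open>c\<close>.\<close>

lemma integral_halfline_derivative:
  fixes F f :: "real \<Rightarrow> real"
  assumes F: "\<And>x. (F has_real_derivative f x) (at x)" and f: "continuous_on UNIV f"
    and supp: "\<And>x. \<bar>x\<bar> > R \<Longrightarrow> F x = 0" "\<And>x. \<bar>x\<bar> > R \<Longrightarrow> f x = 0"
  shows "(LINT x|lborel. indicator {c..} x * f x) = - F c"
proof -
  \<comment> \<open>\<open>B\<close> lies to the right of both the support and \<open>c\<close>, so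
    cutting off at \<open>B\<close> loses nothing and the boundary term \<open>F B\<close>
    vanishes.\<close>
  define B where "B = max \<bar>R\<bar> c + 1"
  have "f x = 0" if "x > B" for x
    by (rule supp) (use that in \<open>auto simp: B_def\<close>)
  then have "indicator {c..} x * f x = f x * indicator {c..B} x" for x
    by (simp add: indicator_def not_le)
  then have "(\<lambda>x. indicator {c..} x * f x) = (\<lambda>x. f x * indicator {c..B} x)"
    by blast
  moreover have "(LINT x|lborel. f x * indicator {c..B} x) = F B - F c"
    using F f by (intro integral_FTC_Icc_real)
      (auto simp: B_def continuous_on_eq_continuous_within)
  moreover have "F B = 0"
    by (rule supp) (auto simp: B_def max_def)
  ultimately show ?thesis by simp
qed

lemma integral_derivative_compact_support:
  fixes F f :: "real \<Rightarrow> real"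
  assumes F: "\<And>x. (F has_real_derivative f x) (at x)" and f: "continuous_on UNIV f"
    and supp: "\<And>x. \<bar>x\<bar> > R \<Longrightarrow> F x = 0" "\<And>x. \<bar>x\<bar> > R \<Longrightarrow> f x = 0"
  shows "(LINT x|lborel. f x) = 0"
proof -
  \<comment> \<open>A half-line that starts to the left of the support captures the whole
    integral.\<close>
  have "f x = 0" if "x < - \<bar>R\<bar> - 1" for x
    by (rule supp) (use that in auto)
  then have "indicator {- \<bar>R\<bar> - 1..} x * f x = f x" for x
    by (auto simp add: indicator_def not_le)
  then have "(\<lambda>x. indicator {- \<bar>R\<bar> - 1..} x * f x) = f"
    by blast
  moreover have "F (- \<bar>R\<bar> - 1) = 0"
    by (rule supp) auto
  ultimately show ?thesis
    using integral_halfline_derivative[OF assms, of R "- \<bar>R\<bar> - 1"] by (simp del: mult_eq_0_iff)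
qed

text \<open>A square instead of a ball: the same \<open>R\<close> then bounds the support of every
  slice in either variable.\<close>

definition vanishes_outside :: "real \<Rightarrow> (real \<times> real \<Rightarrow> real) \<Rightarrow> bool" where
  "vanishes_outside R f \<longleftrightarrow> (\<forall>r t. \<bar>r\<bar> > R \<or> \<bar>t\<bar> > R \<longrightarrow> f (r, t) = 0)"

lemma test_function_bounded_support:
  assumes "test_function \<phi>"
  obtains R where "vanishes_outside R \<phi>"
proof -
  have "bounded {p. \<phi> p \<noteq> 0}"
    using assms compact_imp_bounded bounded_subset closure_subset
    unfolding test_function_def by metis
  then obtain R where R: "\<And>p. \<phi> p \<noteq> 0 \<Longrightarrow> norm p \<le> R"
    by (auto simp: bounded_iff)
  have "\<bar>r\<bar> \<le> norm (r, t)" "\<bar>t\<bar> \<le> norm (r, t)" for r t :: real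
    using norm_fst_le[of r t] norm_snd_le[of t r] by simp_all
  with R show ?thesis
    using that[of R] unfolding vanishes_outside_def by (meson le_less_trans linorder_not_less)
qed

lemma vanishes_outside_partial_r:
  assumes "vanishes_outside R \<phi>"
  shows "vanishes_outside R (partial_r \<phi>)"
  unfolding vanishes_outside_def
proof (intro allI impI)
  fix r t :: real
  assume rt: "\<bar>r\<bar> > R \<or> \<bar>t\<bar> > R"
  \<comment> \<open>If |t| > R the whole slice is zero; otherwise |r| > R, an open condition, so the
    slice is zero near \<open>r\<close>.\<close>
  have "((\<lambda>x. \<phi> (x, t)) has_real_derivative 0) (at r)"
  proof (cases "\<bar>t\<bar> > R")
    case True
    with assms show ?thesis by (simp add: vanishes_outside_def)
  next
    case False
    have "open {x :: real. \<bar>x\<bar> > R}"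
      by (intro open_Collect_less continuous_intros)
    with False rt show ?thesis
      by (intro has_field_derivative_transform_within_open[OF DERIV_const[of 0]])
        (use assms in \<open>auto simp: vanishes_outside_def\<close>)
  qed
  then show "partial_r \<phi> (r, t) = 0" by (simp add: partial_r_def DERIV_imp_deriv)
qed

text \<open>Follows from the case of \<open>partial_r\<close> by swapping the coordinates.\<close>

lemma vanishes_outside_partial_t:
  assumes "vanishes_outside R \<phi>"
  shows "vanishes_outside R (partial_t \<phi>)"
  using vanishes_outside_partial_r[of R "\<lambda>p. \<phi> (snd p, fst p)"] assms
  by (auto simp: partial_r_def partial_t_def vanishes_outside_def)

lemma test_function_C1:
  assumes "test_function \<phi>"
  shows "continuous_on UNIV \<phi>" "continuous_on UNIV (partial_r \<phi>)" "continuous_on UNIV (partial_t \<phi>)"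
    "((\<lambda>x. \<phi> (x, t)) has_real_derivative partial_r \<phi> (r, t)) (at r)"
    "((\<lambda>y. \<phi> (r, y)) has_real_derivative partial_t \<phi> (r, t)) (at t)"
proof -
  have "C_k (Suc 0) \<phi>"
    using assms by (simp only: test_function_def)
  then show "continuous_on UNIV \<phi>" "continuous_on UNIV (partial_r \<phi>)" "continuous_on UNIV (partial_t \<phi>)"
    "((\<lambda>x. \<phi> (x, t)) has_real_derivative partial_r \<phi> (r, t)) (at r)"
    "((\<lambda>y. \<phi> (r, y)) has_real_derivative partial_t \<phi> (r, t)) (at t)"
    by (simp_all add: partial_r_def partial_t_def DERIV_deriv_iff_field_differentiable)
qed

lemma continuous_on_slices:
  fixes f :: "real \<times> real \<Rightarrow> real"
  assumes "continuous_on UNIV f"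
  shows "continuous_on UNIV (\<lambda>r. f (r, t))" "continuous_on UNIV (\<lambda>t. f (r, t))"
  by (rule continuous_on_compose2[OF assms]; auto intro!: continuous_intros)+

lemma integrable_compact_support:
  fixes f :: "'a::euclidean_space \<Rightarrow> real"
  assumes "continuous_on UNIV f" "bounded {x. f x \<noteq> 0}"
  shows "integrable lborel f"
proof -
  let ?K = "closure {x. f x \<noteq> 0}"
  have "integrable lborel (\<lambda>x. indicator ?K x *\<^sub>R f x)"
    by (rule borel_integrable_compact)
      (use assms in \<open>auto intro: continuous_on_subset\<close>)
  moreover have "(\<lambda>x. indicator ?K x *\<^sub>R f x) = f"
    using closure_subset[of "{x. f x \<noteq> 0}"] by (auto simp: fun_eq_iff indicator_def)
  ultimately show ?thesis by simp
qed

lemma vanishes_outside_bounded: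
  assumes "vanishes_outside R f"
  shows "bounded {p. f p \<noteq> 0}" and "bounded {t. f (r, t) \<noteq> 0}"
proof -
  have "{p. f p \<noteq> 0} \<subseteq> {- R..R} \<times> {- R..R}" "{t. f (r, t) \<noteq> 0} \<subseteq> {- R..R}"
    using assms unfolding vanishes_outside_def by force+
  then show "bounded {p. f p \<noteq> 0}" "bounded {t. f (r, t) \<noteq> 0}"
    using bounded_Times bounded_closed_interval bounded_subset by metis+
qed

lemma test_function_integrable:
  assumes "test_function \<phi>"
  shows "integrable lborel \<phi>" "integrable lborel (partial_r \<phi>)" "integrable lborel (partial_t \<phi>)"
    "integrable lborel (\<lambda>t. \<phi> (r, t))"
proof -
  obtain R where R: "vanishes_outside R \<phi>"
    using test_function_bounded_support[OF assms] by blast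
  note c = test_function_C1[OF assms]
  show "integrable lborel \<phi>"
    by (rule integrable_compact_support[OF c(1) vanishes_outside_bounded(1)[OF R]])
  show "integrable lborel (partial_r \<phi>)"
    by (rule integrable_compact_support[OF c(2) vanishes_outside_bounded(1)[OF vanishes_outside_partial_r[OF R]]])
  show "integrable lborel (partial_t \<phi>)"
    by (rule integrable_compact_support[OF c(3) vanishes_outside_bounded(1)[OF vanishes_outside_partial_t[OF R]]])
  show "integrable lborel (\<lambda>t. \<phi> (r, t))"
    by (rule integrable_compact_support[OF continuous_on_slices(2)[OF c(1)] vanishes_outside_bounded(2)[OF R]])
qed

section \<open>Integration by parts on the plane\<close>

lemma integrable_half_plane:
  fixes f :: "real \<times> real \<Rightarrow> real"
  assumes "integrable lborel f"
  shows "integrable lborel (\<lambda>p. indicator {c..} (fst p) * f p)"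
proof (rule Bochner_Integration.integrable_bound[OF assms])
  have [measurable]: "f \<in> borel_measurable lborel" using assms by auto
  have [measurable]: "(\<lambda>p :: real \<times> real. indicator {c..} (fst p) :: real) \<in> borel_measurable borel"
    by (intro borel_measurable_continuous_onI[OF continuous_on_fst[OF continuous_on_id], THEN measurable_compose]) auto
  show "(\<lambda>p. indicator {c..} (fst p) * f p) \<in> borel_measurable lborel"
    by measurable
qed (auto simp: indicator_def)

text \<open>Fubini with r integrated first reduces this to
  \<open>integral_halfline_derivative\<close> on each slice. It makes the r-derivative of a
  half-plane indicator the delta on its boundary line.\<close>

lemma integral_half_plane_partial_r:
  assumes "test_function \<phi>"
  shows "(LINT p|lborel. indicator {c..} (fst p) * partial_r \<phi> p) = - (LINT t|lborel. \<phi> (c, t))"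
proof -
  obtain R where R: "vanishes_outside R \<phi>"
    using test_function_bounded_support[OF assms] by blast
  note c = test_function_C1[OF assms]
  have "integrable (lborel \<Otimes>\<^sub>M lborel) (\<lambda>(r, t). indicator {c..} r * partial_r \<phi> (r, t))"
    using integrable_half_plane[OF test_function_integrable(2)[OF assms], of c]
    by (simp add: lborel_prod case_prod_beta')
  from lborel_pair.integral_snd[OF this]
  have "(LINT p|lborel. indicator {c..} (fst p) * partial_r \<phi> p) =
      (LINT t|lborel. LINT r|lborel. indicator {c..} r * partial_r \<phi> (r, t))"
    by (simp add: lborel_prod case_prod_beta')
  also have "\<dots> = (LINT t|lborel. - \<phi> (c, t))"
    by (intro Bochner_Integration.integral_cong refl
        integral_halfline_derivative[OF c(4) continuous_on_slices(1)[OF c(2)]])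
      (use R vanishes_outside_partial_r[OF R] in \<open>auto simp: vanishes_outside_def\<close>)
  finally show ?thesis by simp
qed

lemma integral_partial_r:
  assumes "test_function \<phi>"
  shows "(LINT p|lborel. partial_r \<phi> p) = 0"
proof -
  obtain R where R: "vanishes_outside R \<phi>"
    using test_function_bounded_support[OF assms] by blast
  note c = test_function_C1[OF assms]
  have "integrable (lborel \<Otimes>\<^sub>M lborel) (\<lambda>(r, t). partial_r \<phi> (r, t))"
    using test_function_integrable(2)[OF assms] by (simp add: lborel_prod)
  from lborel_pair.integral_snd[OF this]
  have "(LINT p|lborel. partial_r \<phi> p) = (LINT t|lborel. LINT r|lborel. partial_r \<phi> (r, t))"
    by (simp add: lborel_prod)
  also have "\<dots> = (LINT t|(lborel :: real measure). 0)"
    by (intro Bochner_Integration.integral_cong refl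
        integral_derivative_compact_support[OF c(4) continuous_on_slices(1)[OF c(2)]])
      (use R vanishes_outside_partial_r[OF R] in \<open>auto simp: vanishes_outside_def\<close>)
  finally show ?thesis by simp
qed

text \<open>The weight depends on r alone, so it leaves the inner t-integral, which is zero by
  compact support.\<close>

lemma integral_weighted_partial_t:
  assumes "test_function \<phi>" and int: "integrable lborel (\<lambda>p. w (fst p) * partial_t \<phi> p)"
  shows "(LINT p|lborel. w (fst p) * partial_t \<phi> p) = 0"
proof -
  obtain R where R: "vanishes_outside R \<phi>"
    using test_function_bounded_support[OF assms(1)] by blast
  note c = test_function_C1[OF assms(1)]
  have "(LINT t|lborel. partial_t \<phi> (r, t)) = 0" for r
    by (rule integral_derivative_compact_support[OF c(5) continuous_on_slices(2)[OF c(3)]])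
      (use R vanishes_outside_partial_t[OF R] in \<open>auto simp: vanishes_outside_def\<close>)
  then show ?thesis
    using lborel_pair.integral_fst'[of "\<lambda>p. w (fst p) * partial_t \<phi> p"] int
    by (simp add: lborel_prod)
qed

section \<open>Step functions in r as distributions\<close>

text \<open>Base value plus jumps times Heaviside functions, so that the distributional derivative
  can be read off from the jumps.\<close>

definition steps :: "real \<Rightarrow> real \<Rightarrow> real \<Rightarrow> real \<Rightarrow> real \<Rightarrow> real \<Rightarrow> real" where
  "steps a b c1 c2 c3 r = c1 + (c2 - c1) * indicator {a..} r + (c3 - c2) * indicator {b..} r"

lemma negligible_lines: "negligible {p :: real \<times> real. fst p \<in> {a, b}}"
proof -
  have "{p :: real \<times> real. fst p \<in> {a, b}} = {p. (1, 0) \<bullet> p = a} \<union> {p. (1, 0) \<bullet> p = b}"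
    by (auto simp: inner_prod_def)
  moreover have "negligible {p :: real \<times> real. (1, 0) \<bullet> p = c}" for c
    by (rule negligible_hyperplane) (simp add: zero_prod_def)
  ultimately show ?thesis by (simp add: negligible_Un)
qed

lemma integral_steps:
  fixes \<psi> :: "real \<times> real \<Rightarrow> real"
  assumes "integrable lborel \<psi>"
  shows "integrable lborel (\<lambda>p. steps a b c1 c2 c3 (fst p) * \<psi> p)"
    and "(LINT p|lborel. steps a b c1 c2 c3 (fst p) * \<psi> p) =
      c1 * (LINT p|lborel. \<psi> p) + (c2 - c1) * (LINT p|lborel. indicator {a..} (fst p) * \<psi> p)
      + (c3 - c2) * (LINT p|lborel. indicator {b..} (fst p) * \<psi> p)"
proof -
  have *: "(\<lambda>p. steps a b c1 c2 c3 (fst p) * \<psi> p) = (\<lambda>p. c1 * \<psi> p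
      + (c2 - c1) * (indicator {a..} (fst p) * \<psi> p) + (c3 - c2) * (indicator {b..} (fst p) * \<psi> p))"
    by (simp add: steps_def algebra_simps)
  note i = assms integrable_half_plane[OF assms]
  show "integrable lborel (\<lambda>p. steps a b c1 c2 c3 (fst p) * \<psi> p)"
    unfolding * by (intro Bochner_Integration.integrable_add integrable_mult_right i)
  show "(LINT p|lborel. steps a b c1 c2 c3 (fst p) * \<psi> p) =
      c1 * (LINT p|lborel. \<psi> p) + (c2 - c1) * (LINT p|lborel. indicator {a..} (fst p) * \<psi> p)
      + (c3 - c2) * (LINT p|lborel. indicator {b..} (fst p) * \<psi> p)"
    unfolding * by (simp add: i)
qed

text \<open>\<open>f\<close> is arbitrary on the two lines, so it need not be Borel measurable.
  Since the lines are negligible, integrability and the value of the integral are transferred from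
  the Borel function \<open>steps\<close> through the gauge integral.\<close>

lemma regular_distr_steps:
  fixes \<psi> :: "real \<times> real \<Rightarrow> real"
  assumes int: "integrable lborel \<psi>"
    and f: "\<And>r t. r \<notin> {a, b} \<Longrightarrow> f (r, t) = steps a b c1 c2 c3 r"
  shows "regular_distr f \<psi> = (LINT p|lborel. steps a b c1 c2 c3 (fst p) * \<psi> p)"
proof -
  let ?g = "\<lambda>p. steps a b c1 c2 c3 (fst p) * \<psi> p"
  note i = integral_steps(1)[OF int, of a b c1 c2 c3]
  have g: "?g absolutely_integrable_on UNIV"
    using i by (simp add: set_integrable_def integrable_completion)
  have fg: "f p * \<psi> p = ?g p" if "p \<in> UNIV - {p. fst p \<in> {a, b}}" for p
    using that f[of "fst p" "snd p"] by simp
  have "(\<lambda>p. f p * \<psi> p) absolutely_integrable_on UNIV"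
    by (rule absolutely_integrable_spike[OF g negligible_lines fg])
  then have "regular_distr f \<psi> = integral UNIV (\<lambda>p. f p * \<psi> p)"
    using set_lebesgue_integral_eq_integral(2)[of UNIV "\<lambda>p. f p * \<psi> p"]
    by (simp add: regular_distr_def set_lebesgue_integral_def)
  also have "\<dots> = integral UNIV ?g"
    by (rule integral_spike[OF negligible_lines fg[symmetric]])
  also have "\<dots> = (LINT p|lborel. ?g p)"
    by (rule integral_lborel[OF i])
  finally show ?thesis .
qed

lemma locally_integrable_steps:
  assumes f: "\<And>r t. r \<notin> {a, b} \<Longrightarrow> f (r, t) = steps a b c1 c2 c3 r"
  shows "locally_integrable f"
  unfolding locally_integrable_def
proof (intro allI impI)
  fix K :: "(real \<times> real) set"
  assume K: "compact K"
  \<comment> \<open>The indicator of \<open>K\<close> plays the role of the integrable factor in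
    \<open>integral_steps\<close>.\<close>
  have "integrable lborel (\<lambda>p. indicator K p *\<^sub>R (1 :: real))"
    by (rule borel_integrable_compact[OF K]) simp
  from integral_steps(1)[OF this, of a b c1 c2 c3]
  have "integrable lborel (\<lambda>p. indicator K p *\<^sub>R steps a b c1 c2 c3 (fst p))"
    by (simp add: mult.commute)
  then have "(\<lambda>p. steps a b c1 c2 c3 (fst p)) absolutely_integrable_on K"
    by (simp add: set_integrable_def integrable_completion)
  then show "f absolutely_integrable_on K"
  proof (rule absolutely_integrable_spike[OF _ negligible_lines])
    fix p :: "real \<times> real"
    assume "p \<in> K - {p. fst p \<in> {a, b}}"
    then show "f p = steps a b c1 c2 c3 (fst p)"
      using f[of "fst p" "snd p"] by simp
  qed
qed

lemma distr_dt_steps: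
  assumes \<phi>: "test_function \<phi>"
    and f: "\<And>r t. r \<notin> {a, b} \<Longrightarrow> f (r, t) = steps a b c1 c2 c3 r"
  shows "distr_dt (regular_distr f) \<phi> = 0"
proof -
  note i = test_function_integrable(3)[OF \<phi>]
  have "regular_distr f (partial_t \<phi>) = (LINT p|lborel. steps a b c1 c2 c3 (fst p) * partial_t \<phi> p)"
    by (rule regular_distr_steps[OF i f])
  also have "\<dots> = 0"
    by (rule integral_weighted_partial_t[OF \<phi> integral_steps(1)[OF i]])
  finally show ?thesis by (simp add: distr_dt_def)
qed

text \<open>The base value \<open>c1\<close> contributes nothing, and the sign in
  \<open>distr_dr\<close> cancels the one from the half-plane integrals, leaving each jump as the
  coefficient of its delta.\<close>

lemma distr_dr_steps:
  assumes \<phi>: "test_function \<phi>"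
    and f: "\<And>r t. r \<notin> {a, b} \<Longrightarrow> f (r, t) = steps a b c1 c2 c3 r"
  shows "distr_dr (regular_distr f) \<phi> =
    (c2 - c1) * (LINT t|lborel. \<phi> (a, t)) + (c3 - c2) * (LINT t|lborel. \<phi> (b, t))"
proof -
  note i = test_function_integrable(2)[OF \<phi>]
  have "regular_distr f (partial_r \<phi>) = (LINT p|lborel. steps a b c1 c2 c3 (fst p) * partial_r \<phi> p)"
    by (rule regular_distr_steps[OF i f])
  then show ?thesis
    unfolding distr_dr_def integral_steps(2)[OF i] integral_half_plane_partial_r[OF \<phi>] integral_partial_r[OF \<phi>]
    by (simp add: algebra_simps)
qed

lemma mult_dV_const:
  assumes "test_function \<phi>" and "\<And>p. n p = N"
  shows "mult_dV a b V0 n \<phi> =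
    V0 * N * ((LINT t|lborel. \<phi> (a, t)) - (LINT t|lborel. \<phi> (b, t)))"
proof -
  note i = test_function_integrable(4)[OF assms(1)]
  have "(LINT t|lebesgue. N * \<phi> (a, t) - N * \<phi> (b, t)) = (LINT t|lborel. N * \<phi> (a, t) - N * \<phi> (b, t))"
    using i by (intro integral_completion) auto
  then show ?thesis
    using i by (simp add: mult_dV_def assms(2) right_diff_distrib)
qed

subsection \<open>Localisation with bump functions\<close>

text \<open>Otherwise \<open>f\<close> would vanish almost everywhere, making the nonempty open set
  where it is nonzero a null set.\<close>

lemma integral_pos_continuous:
  fixes f :: "'a::euclidean_space \<Rightarrow> real"
  assumes "integrable lborel f" "continuous_on UNIV f" "\<And>x. f x \<ge> 0" "f x0 > 0"
  shows "(LINT x|lborel. f x) > 0"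
proof (rule ccontr)
  assume "\<not> ?thesis"
  moreover have "(LINT x|lborel. f x) \<ge> 0"
    using assms by (simp add: Bochner_Integration.integral_nonneg)
  ultimately have "(LINT x|lborel. f x) = 0"
    by linarith
  then have "AE x in lborel. f x = 0"
    by (subst (asm) integral_nonneg_eq_0_iff_AE[OF assms(1)]) (simp_all add: assms(3))
  moreover have op: "open {x. f x \<noteq> 0}"
    by (intro open_Collect_neq assms(2) continuous_intros)
  ultimately have "{x. f x \<noteq> 0} \<in> null_sets lborel"
    by (subst (asm) AE_iff_null) auto
  then have "negligible {x. f x \<noteq> 0}"
    by (simp add: negligible_iff_null_sets null_sets_completionI)
  then show False
    using open_not_negligible[OF op] assms(4) by (metis (mono_tags) empty_iff less_irrefl mem_Collect_eq)
qed

text \<open>Only the position in r has to be adjusted, as all the data to be separated are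
  independent of t; the time window (0, 1) is fixed.\<close>

definition tensor_bump :: "real \<Rightarrow> real \<Rightarrow> real \<times> real \<Rightarrow> real" where
  "tensor_bump l u p = bump l u (fst p) * bump 0 1 (snd p)"

lemma test_function_tensor_bump: "test_function (tensor_bump l u)"
  using test_function_bump[of l u 0 1] by (simp add: tensor_bump_def[abs_def])

lemma integral_tensor_bump_slice:
  assumes "l < x" "x < u"
  shows "(LINT t|lborel. tensor_bump l u (x, t)) > 0"
proof (rule integral_pos_continuous)
  show "integrable lborel (\<lambda>t. tensor_bump l u (x, t))"
    by (rule test_function_integrable(4)[OF test_function_tensor_bump])
  show "continuous_on UNIV (\<lambda>t. tensor_bump l u (x, t))"
    by (rule continuous_on_slices(2)[OF test_function_C1(1)[OF test_function_tensor_bump]])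
  show "tensor_bump l u (x, 1 / 2) > 0"
    using assms by (simp add: tensor_bump_def bump_pos_iff)
qed (simp add: tensor_bump_def bump_nonneg)

lemma tensor_bump_outside: "x \<le> l \<or> u \<le> x \<Longrightarrow> tensor_bump l u (x, t) = 0"
  using bump_nonzero_iff[of l u x] by (auto simp: tensor_bump_def)

text \<open>The bump is zero outside the strip, so \<open>f\<close> acts on it as the constant
  \<open>c\<close> times its integral, which is positive.\<close>

lemma regular_distr_tensor_bump_eq_0:
  assumes "l < u" and f: "\<And>r t. l < r \<Longrightarrow> r < u \<Longrightarrow> f (r, t) = c"
    and 0: "regular_distr f (tensor_bump l u) = 0"
  shows "c = 0"
proof -
  note T = test_function_tensor_bump[of l u]
  have "f p * tensor_bump l u p = c * tensor_bump l u p" for p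
    using f[of "fst p" "snd p"] tensor_bump_outside[of "fst p" l u "snd p"] by fastforce
  then have "regular_distr f (tensor_bump l u) = (LINT p|lebesgue. c * tensor_bump l u p)"
    unfolding regular_distr_def by presburger
  also have "\<dots> = (LINT p|lborel. c * tensor_bump l u p)"
    using test_function_integrable(1)[OF T] by (intro integral_completion) auto
  finally have "c * (LINT p|lborel. tensor_bump l u p) = 0"
    using 0 by simp
  moreover have "(LINT p|lborel. tensor_bump l u p) > 0"
  proof (rule integral_pos_continuous[OF test_function_integrable(1)[OF T] test_function_C1(1)[OF T]])
    show "tensor_bump l u ((l + u) / 2, 1 / 2) > 0"
      using assms(1) by (simp add: tensor_bump_def bump_pos_iff field_simps)
  qed (simp add: tensor_bump_def bump_nonneg)
  ultimately show ?thesis by simp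
qed

text \<open>The bump over (a - 1, b) vanishes on the line r = b and isolates \<open>p\<close>; the
  one over (a, b + 1) vanishes on r = a and isolates \<open>q\<close>.\<close>

lemma delta_coefficients_eq_0:
  assumes "a < b"
    and eq: "\<And>\<phi>. test_function \<phi> \<Longrightarrow>
      p * (LINT t|lborel. \<phi> (a, t)) + q * (LINT t|lborel. \<phi> (b, t)) = 0"
  shows "p = 0" "q = 0"
  using eq[OF test_function_tensor_bump, of "a - 1" b] eq[OF test_function_tensor_bump, of a "b + 1"]
    integral_tensor_bump_slice[of "a - 1" a b] integral_tensor_bump_slice[of a b "b + 1"] assms(1)
  by (auto simp: tensor_bump_outside)

lemma steps_simps:
  assumes "a < b"
  shows "r < a \<Longrightarrow> steps a b c1 c2 c3 r = c1"
    "a < r \<Longrightarrow> r < b \<Longrightarrow> steps a b c1 c2 c3 r = c2"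
    "b < r \<Longrightarrow> steps a b c1 c2 c3 r = c3"
  using assms by (simp_all add: steps_def)

lemma steps_const [simp]: "steps a b c c c r = c"
  by (simp add: steps_def)

text \<open>Common shape of the four equations for n_2, n_3, J_2 and J_3, with \<open>K\<close>
  equal to the coupling 2 v_F / hbar up to sign.\<close>

lemma steps_plus_delta_eq_0:
  assumes "a < b"
    and f: "\<And>r t. r \<notin> {a, b} \<Longrightarrow> f (r, t) = steps a b c1 c2 c3 r"
    and K: "K \<noteq> 0"
    and eq: "\<And>\<phi>. test_function \<phi> \<Longrightarrow>
      K * regular_distr f \<phi> + d * ((LINT t|lborel. \<phi> (a, t)) - (LINT t|lborel. \<phi> (b, t))) = 0"
  shows "c1 = 0" "c2 = 0" "c3 = 0" "d = 0"
proof -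
  \<comment> \<open>An open strip that contains neither line carries a bump that is zero on both, so
    the delta terms drop out.\<close>
  have reg: "regular_distr f (tensor_bump l u) = 0" if "u \<le> a \<or> a \<le> l" "u \<le> b \<or> b \<le> l" for l u
    using eq[OF test_function_tensor_bump, of l u] that K by (auto simp: tensor_bump_outside)
  note v = steps_simps[OF \<open>a < b\<close>]
  show c1: "c1 = 0"
    by (rule regular_distr_tensor_bump_eq_0[OF _ _ reg, of "a - 1" a])
      (use f v \<open>a < b\<close> in auto)
  show c2: "c2 = 0"
    by (rule regular_distr_tensor_bump_eq_0[OF _ _ reg, of a b])
      (use f v \<open>a < b\<close> in auto)
  show c3: "c3 = 0"
    by (rule regular_distr_tensor_bump_eq_0[OF _ _ reg, of b "b + 1"])
      (use f v \<open>a < b\<close> in auto)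
  \<comment> \<open>With all three values zero, \<open>f\<close> is the zero distribution, so only
    the deltas remain for every test function.\<close>
  have "regular_distr f \<phi> = 0" if "test_function \<phi>" for \<phi>
    using regular_distr_steps[OF test_function_integrable(1)[OF that], of a b f c1 c2 c3] f c1 c2 c3
    by simp
  with eq have "d * (LINT t|lborel. \<phi> (a, t)) + (- d) * (LINT t|lborel. \<phi> (b, t)) = 0"
    if "test_function \<phi>" for \<phi>
    using that by (simp add: right_diff_distrib)
  from delta_coefficients_eq_0[OF \<open>a < b\<close> this] show "d = 0" by simp
qed

section \<open>From the system to relations between constants\<close>

lemma piecewise_constant_steps:
  assumes "piecewise_constant a b n J" "a < b"
  obtains N c1 c2 c3 where
    "\<And>s p. s < 4 \<Longrightarrow> n s p = N s"
    "\<And>s r t. s < 4 \<Longrightarrow> r \<notin> {a, b} \<Longrightarrow> J s (r, t) = steps a b (c1 s) (c2 s) (c3 s) r"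
proof -
  have "\<exists>N c1 c2 c3. (\<forall>p. n s p = N) \<and>
      (\<forall>r t. r \<notin> {a, b} \<longrightarrow> J s (r, t) = steps a b c1 c2 c3 r)" if "s < 4" for s
  proof -
    from assms(1) that obtain N c1 c2 c3 where
      "\<And>p. n s p = N"
      "\<And>r t. r < a \<Longrightarrow> J s (r, t) = c1"
      "\<And>r t. a < r \<Longrightarrow> r < b \<Longrightarrow> J s (r, t) = c2"
      "\<And>r t. b < r \<Longrightarrow> J s (r, t) = c3"
      unfolding piecewise_constant_def constant_on_def by fastforce
    moreover from this have "J s (r, t) = steps a b c1 c2 c3 r" if "r \<notin> {a, b}" for r t
      using steps_simps[OF assms(2)] that by (cases "r < a"; cases "r < b") auto
    ultimately show ?thesis by blast
  qed
  then show ?thesis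
    using that by metis
qed

theorem proposition13:
  fixes vF hbar m \<theta> a b V0 :: real
    and n J :: "nat \<Rightarrow> real \<times> real \<Rightarrow> real"
  assumes "vF > 0" and "hbar > 0" and "m > 0" and "\<theta> > 0"
    and "a < b" and "V0 \<noteq> 0"
    and "piecewise_constant a b n J"
    and "\<forall>p. n 0 p > 0"
  shows "QFDE_solution vF hbar m \<theta> a b V0 n J \<longleftrightarrow>
    (\<exists>\<beta>0 \<beta>1. \<forall>r t. r \<notin> {a, b} \<longrightarrow>
       n 2 (r, t) = 0 \<and> n 3 (r, t) = 0 \<and> J 2 (r, t) = 0 \<and> J 3 (r, t) = 0 \<and>
       vF * J 0 (r, t) + n 1 (r, t) * potential a b V0 r = \<beta>0 \<and>
       vF * J 1 (r, t) + n 0 (r, t) * potential a b V0 r = \<beta>1)"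
proof -
  obtain N c1 c2 c3 where
    n: "\<And>s p. s < 4 \<Longrightarrow> n s p = N s" and
    J: "\<And>s r t. s < 4 \<Longrightarrow> r \<notin> {a, b} \<Longrightarrow> J s (r, t) = steps a b (c1 s) (c2 s) (c3 s) r"
    using piecewise_constant_steps[OF assms(7,5)] by blast
  \<comment> \<open>Value of the bracket on a region where \<open>J\<close> takes the constants
    \<open>c\<close>; the bracket, though nonlinear, is thus again a step function.\<close>
  define B where "B c s = (m * \<theta> - (c 0)\<^sup>2 / (N 0)\<^sup>2) * N s + 2 / N 0 * c 0 * c s"
    for c :: "nat \<Rightarrow> real" and s
  note v = steps_simps[OF \<open>a < b\<close>]
  have N0: "N 0 > 0"
    using assms(8) n[of 0] by simp
  have bracket: "QFDE_bracket m \<theta> n J s (r, t) = steps a b (B c1 s) (B c2 s) (B c3 s) r"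
    if s: "s < 4" and r: "r \<notin> {a, b}" for s r t
  proof -
    consider "r < a" | "a < r" "r < b" | "b < r"
      using r by fastforce
    then show ?thesis
      using J[OF s r, of t] J[of 0 r t] s r n by cases (simp_all add: QFDE_bracket_def B_def v)
  qed
  \<comment> \<open>Constants are steps without jumps, so the same derivative formulas cover
    \<open>n\<close>.\<close>
  have nsteps: "n s (r, t) = steps a b (N s) (N s) (N s) r" if "s < 4" for s r t
    using n that by simp
  let ?A = "\<lambda>\<phi>. LINT t|lborel. \<phi> (a, t)" and ?B = "\<lambda>\<phi>. LINT t|lborel. \<phi> (b, t)"
  have dtn: "distr_dt (regular_distr (n s)) \<phi> = 0"
    and drn: "distr_dr (regular_distr (n s)) \<phi> = 0"
    and dtJ: "distr_dt (regular_distr (J s)) \<phi> = 0"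
    and drJ: "distr_dr (regular_distr (J s)) \<phi> = (c2 s - c1 s) * ?A \<phi> + (c3 s - c2 s) * ?B \<phi>"
    and ndV: "mult_dV a b V0 (n s) \<phi> = V0 * N s * (?A \<phi> - ?B \<phi>)"
    if "test_function \<phi>" "s < 4" for \<phi> s
    using distr_dt_steps[OF that(1) nsteps[OF that(2)]] distr_dr_steps[OF that(1) nsteps[OF that(2)]]
      distr_dt_steps[OF that(1) J[OF that(2)]] distr_dr_steps[OF that(1) J[OF that(2)]]
      mult_dV_const[OF that(1) n[OF that(2)]]
    by simp_all
  show ?thesis
  proof
    assume sol: "QFDE_solution vF hbar m \<theta> a b V0 n J"
    have K: "2 * vF / hbar \<noteq> 0" "- (2 * vF / hbar) \<noteq> 0"
      using assms by simp_all
    \<comment> \<open>The equations for n_2 and n_3 have no delta term; the summand with coefficient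
      0 gives them the shape of \<open>steps_plus_delta_eq_0\<close>.\<close>
    have J3: "2 * vF / hbar * regular_distr (J 3) \<phi> + 0 * (?A \<phi> - ?B \<phi>) = 0"
      and J2: "- (2 * vF / hbar) * regular_distr (J 2) \<phi> + 0 * (?A \<phi> - ?B \<phi>) = 0"
      and J1: "(vF * (c2 1 - c1 1) + V0 * N 0) * ?A \<phi> + (vF * (c3 1 - c2 1) - V0 * N 0) * ?B \<phi> = 0"
      and J0: "(vF * (c2 0 - c1 0) + V0 * N 1) * ?A \<phi> + (vF * (c3 0 - c2 0) - V0 * N 1) * ?B \<phi> = 0"
      and B3: "2 * vF / hbar * regular_distr (QFDE_bracket m \<theta> n J 3) \<phi> + V0 * N 2 * (?A \<phi> - ?B \<phi>) = 0"
      and B2: "- (2 * vF / hbar) * regular_distr (QFDE_bracket m \<theta> n J 2) \<phi> + V0 * N 3 * (?A \<phi> - ?B \<phi>) = 0"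
      if \<phi>: "test_function \<phi>" for \<phi>
      using sol \<phi> unfolding QFDE_solution_def
      by (auto simp: dtn[OF \<phi>] drn[OF \<phi>] dtJ[OF \<phi>] drJ[OF \<phi>] ndV[OF \<phi>] algebra_simps)
    \<comment> \<open>The delta coefficients in the equations for J_2 and J_3 are
      \<open>V0 * N 2\<close> and \<open>V0 * N 3\<close>.\<close>
    have "N 2 = 0" "N 3 = 0"
      using steps_plus_delta_eq_0(4)[OF \<open>a < b\<close> bracket K(1) B3]
        steps_plus_delta_eq_0(4)[OF \<open>a < b\<close> bracket K(2) B2] \<open>V0 \<noteq> 0\<close> by simp_all
    moreover have "c1 3 = 0" "c2 3 = 0" "c3 3 = 0"
      using steps_plus_delta_eq_0(1-3)[OF \<open>a < b\<close> J K(1) J3] by simp_all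
    moreover have "c1 2 = 0" "c2 2 = 0" "c3 2 = 0"
      using steps_plus_delta_eq_0(1-3)[OF \<open>a < b\<close> J K(2) J2] by simp_all
    moreover note \<open>a < b\<close> delta_coefficients_eq_0[OF \<open>a < b\<close> J0] delta_coefficients_eq_0[OF \<open>a < b\<close> J1]
    \<comment> \<open>The potential is zero for r < a, so the values on the left region,
      \<open>vF * c1 0\<close> and \<open>vF * c1 1\<close>, are the required constants; the jump
      relations carry them across both lines.\<close>
    ultimately have "\<forall>r t. r \<notin> {a, b} \<longrightarrow>
       n 2 (r, t) = 0 \<and> n 3 (r, t) = 0 \<and> J 2 (r, t) = 0 \<and> J 3 (r, t) = 0 \<and>
       vF * J 0 (r, t) + n 1 (r, t) * potential a b V0 r = vF * c1 0 \<and>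
       vF * J 1 (r, t) + n 0 (r, t) * potential a b V0 r = vF * c1 1"
      by (auto simp: n J steps_def potential_def indicator_def algebra_simps)
    then show "\<exists>\<beta>0 \<beta>1. \<forall>r t. r \<notin> {a, b} \<longrightarrow>
       n 2 (r, t) = 0 \<and> n 3 (r, t) = 0 \<and> J 2 (r, t) = 0 \<and> J 3 (r, t) = 0 \<and>
       vF * J 0 (r, t) + n 1 (r, t) * potential a b V0 r = \<beta>0 \<and>
       vF * J 1 (r, t) + n 0 (r, t) * potential a b V0 r = \<beta>1"
      by blast
  next
    assume "\<exists>\<beta>0 \<beta>1. \<forall>r t. r \<notin> {a, b} \<longrightarrow>
       n 2 (r, t) = 0 \<and> n 3 (r, t) = 0 \<and> J 2 (r, t) = 0 \<and> J 3 (r, t) = 0 \<and>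
       vF * J 0 (r, t) + n 1 (r, t) * potential a b V0 r = \<beta>0 \<and>
       vF * J 1 (r, t) + n 0 (r, t) * potential a b V0 r = \<beta>1"
    then obtain \<beta>0 \<beta>1 where \<beta>: "\<And>r t. r \<notin> {a, b} \<Longrightarrow>
       n 2 (r, t) = 0 \<and> n 3 (r, t) = 0 \<and> J 2 (r, t) = 0 \<and> J 3 (r, t) = 0 \<and>
       vF * J 0 (r, t) + n 1 (r, t) * potential a b V0 r = \<beta>0 \<and>
       vF * J 1 (r, t) + n 0 (r, t) * potential a b V0 r = \<beta>1"
      by blast
    \<comment> \<open>One sample point in each region recovers all the constants.\<close>
    have N23: "N 2 = 0" "N 3 = 0"
      and c: "c1 2 = 0" "c1 3 = 0" "c2 2 = 0" "c2 3 = 0" "c3 2 = 0" "c3 3 = 0"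
      and c0: "vF * c2 0 = vF * c1 0 - V0 * N 1" "vF * c3 0 = vF * c1 0"
      and c1: "vF * c2 1 = vF * c1 1 - V0 * N 0" "vF * c3 1 = vF * c1 1"
      using \<beta>[of "a - 1" 0] \<beta>[of "(a + b) / 2" 0] \<beta>[of "b + 1" 0] \<open>a < b\<close> \<open>vF > 0\<close>
      by (auto simp: n J v potential_def field_simps)
    have zero: "regular_distr f \<phi> = 0"
      if "test_function \<phi>" "\<And>r t. r \<notin> {a, b} \<Longrightarrow> f (r, t) = steps a b 0 0 0 r" for f \<phi>
      using regular_distr_steps[OF test_function_integrable(1)[OF that(1)] that(2)] by simp
    \<comment> \<open>For s = 2, 3 the bracket value \<open>B c s\<close> is linear in the pair
      \<open>N s\<close>, \<open>c s\<close>, so it vanishes with them.\<close>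
    have off: "J s (r, t) = steps a b 0 0 0 r" "QFDE_bracket m \<theta> n J s (r, t) = steps a b 0 0 0 r"
      if s: "s \<in> {2, 3}" and r: "r \<notin> {a, b}" for s r t
    proof -
      have "s < 4" using s by auto
      from J[OF this r] bracket[OF this r] s N23 c
      show "J s (r, t) = steps a b 0 0 0 r" "QFDE_bracket m \<theta> n J s (r, t) = steps a b 0 0 0 r"
        by (auto simp: B_def)
    qed
    have J23: "regular_distr (J s) \<phi> = 0" "regular_distr (QFDE_bracket m \<theta> n J s) \<phi> = 0"
      if "test_function \<phi>" "s \<in> {2, 3}" for s \<phi>
      using zero[OF that(1) off(1)[OF that(2)]] zero[OF that(1) off(2)[OF that(2)]] by simp_all
    \<comment> \<open>The jumps of \<open>vF * J\<close> at the two lines are opposite and cancel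
      those of the potential term. \<open>A\<close> and \<open>B\<close> stand for the integrals of
      the test function along the lines.\<close>
    have J1: "vF * ((c2 1 - c1 1) * A + (c3 1 - c2 1) * B) + V0 * N 0 * (A - B) = 0"
      and J0: "vF * ((c2 0 - c1 0) * A + (c3 0 - c2 0) * B) + V0 * N 1 * (A - B) = 0" for A B
      using c0 c1 by algebra+
    have "continuous_on UNIV (n s)" "locally_integrable (J s)"
      "locally_integrable (QFDE_bracket m \<theta> n J s)" if "s < 4" for s
      using locally_integrable_steps[OF J[OF that]] locally_integrable_steps[OF bracket[OF that]]
        n[OF that] by (simp_all add: n[OF that, abs_def])
    moreover have "n 0 p \<noteq> 0" for p
      using N0 n by simp
    ultimately show "QFDE_solution vF hbar m \<theta> a b V0 n J"
      unfolding QFDE_solution_def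
      by (auto simp: dtn drn dtJ drJ ndV J23 J0 J1 N23 simp del: One_nat_def)
  qed
qed

end
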